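(* Let \[ M_1=\begin{pmatrix} -1 & 2 & 2 \\ -2 & 1 & 2 \\ -2 & 2 & 3 \end{pmatrix},\quad M_2=\begin{pmatrix} 1 & 2 & 2 \\ 2 & 1 & 2 \\ 2 & 2 & 3 \end{pmatrix},\quad M_3=\begin{pmatrix} 1 & -2 & 2 \\ 2 & -1 & 2 \\ 2 & -2 & 3 \end{pmatrix}, \] and let $M=M_{d_1}\cdots M_{d_k}$ for some $d_1,\dots,d_k\in\{1,2,3\}$, where not all $d_j$ equal $1$ and not all $d_j$ equal $3$. Then there exists a real quadratic field $K$ (with nontrivial automorphism $\sigma$ over $\mathbb{Q}$) such that: (1) one eigenvalue of $M$ is some $\lambda_1>1$ with $\lambda_1\in K$; another eigenvalue is $\lambda_2:=\lambda_1^\sigma$ with $0<\lambda_2<1$; the third eigenvalue is $\lambda_3=\det(M)\in\{1,-1\}$; (2) a nonzero eigenvector associated to $\lambda_1$ is $Q$-null (i.e.\ $x_1^2+x_2^2-x_3^2=0$) and represents a point $(\alpha,\beta)\in\mathscr{Q}$ with $\alpha,\beta\in K$; write $\mathbf{v}_1:=(\alpha,\beta,1)$; (3) $\mathbf{v}_2:=(\alpha^\sigma,\beta^\sigma,1)$ is an eigenvector associated to $\lambda_2$; (4) $\mathbf{v}_3:=\mathbf{v}_1\times_Q\mathbf{v}_2$ is an eigenvector associated to $\lambda_3$.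
   Context: $\mathscr{Q}=\{(x,y)\in\mathbb{R}^2: x\ge0,\ y\ge0,\ x^2+y^2=1\}$. A vector $(v_1,v_2,v_3)$ with $v_3\ne0$ represents the point $(v_1/v_3,v_2/v_3)\in\mathbb{R}^2$. The $Q$-cross product of $(a_1,b_1,c_1)$ and $(a_2,b_2,c_2)$ is $(b_1c_2-b_2c_1,\ a_2c_1-a_1c_2,\ a_2b_1-a_1b_2)$. *)

theory Defs
  imports
    "Jordan_Normal_Form.Spectral_Radius"
    "HOL-Algebra.Algebraic_Closure_Type"
begin

definition gen_mat :: "nat \<Rightarrow> real mat" where
  "gen_mat d =
    (if d = 1 then mat_of_rows_list 3 [[-1, 2, 2], [-2, 1, 2], [-2, 2, 3]]
     else if d = 2 then mat_of_rows_list 3 [[1, 2, 2], [2, 1, 2], [2, 2, 3]]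
     else mat_of_rows_list 3 [[1, -2, 2], [2, -1, 2], [2, -2, 3]])"

definition word_mat :: "nat list \<Rightarrow> real mat" where
  "word_mat ds = foldr (\<lambda>d A. gen_mat d * A) ds (1\<^sub>m 3)"

definition quarter_circle :: "(real \<times> real) set" where
  "quarter_circle = {(x, y). x \<ge> 0 \<and> y \<ge> 0 \<and> x\<^sup>2 + y\<^sup>2 = 1}"

definition represents :: "real vec \<Rightarrow> real \<times> real \<Rightarrow> bool" where
  "represents v p \<longleftrightarrow> v $ 2 \<noteq> 0 \<and> p = (v $ 0 / v $ 2, v $ 1 / v $ 2)"

definition Q_null :: "real vec \<Rightarrow> bool" where
  "Q_null v \<longleftrightarrow> (v $ 0)\<^sup>2 + (v $ 1)\<^sup>2 - (v $ 2)\<^sup>2 = 0"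

definition Q_cross :: "real vec \<Rightarrow> real vec \<Rightarrow> real vec" where
  "Q_cross v w = vec_of_list
    [v $ 1 * w $ 2 - w $ 1 * v $ 2,
     w $ 0 * v $ 2 - v $ 0 * w $ 2,
     w $ 0 * v $ 1 - v $ 0 * w $ 1]"

abbreviation real_ring :: "real ring" where
  "real_ring \<equiv> ring_of_type_algebra"

definition real_quadratic_field :: "real set \<Rightarrow> bool" where
  "real_quadratic_field K \<longleftrightarrow> subfield K real_ring \<and> ring.dimension real_ring 2 \<rat> K"

text \<open>Only the values of \<open>\<sigma>\<close> on \<open>K\<close> are constrained; outside \<open>K\<close> the function is arbitrary.\<close>

definition nontrivial_automorphism :: "real set \<Rightarrow> (real \<Rightarrow> real) \<Rightarrow> bool" where
  "nontrivial_automorphism K \<sigma> \<longleftrightarrow>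
     \<sigma> \<in> ring_iso (real_ring\<lparr>carrier := K\<rparr>) (real_ring\<lparr>carrier := K\<rparr>) \<and>
     (\<forall>q\<in>\<rat>. \<sigma> q = q) \<and> (\<exists>x\<in>K. \<sigma> x \<noteq> x)"

end

theory Submission
  imports Defs
begin

text \<open>
  In the coordinates \<open>(p\<^sup>2, p q, q\<^sup>2)\<close> of the null cone, the generators are the symmetric squares of
  \<open>(1 2; 0 1)\<close>, \<open>(1 2; 1 1)\<close> and \<open>(1 0; 1 1)\<close>. So \<open>M\<close> is the symmetric square of a nonnegative
  integer matrix \<open>A = (a b; c d)\<close> of determinant \<open>\<plusminus>1\<close>, and \<open>b\<close>, \<open>c\<close> are both positive because the
  word is neither all 1 nor all 3. Then \<open>(tr A)\<^sup>2 - 4 det A\<close> is positive and not a square, so \<open>A\<close> has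
  conjugate eigenvalues \<open>m\<^sub>1 > 1\<close>, \<open>m\<^sub>2\<close> in a real quadratic field, with eigenvectors \<open>(w\<^sub>1, 1)\<close>, \<open>(w\<^sub>2, 1)\<close>.
  The eigenvalues of \<open>M\<close> are \<open>m\<^sub>1\<^sup>2\<close>, \<open>m\<^sub>2\<^sup>2\<close> and \<open>m\<^sub>1 m\<^sub>2 = det A = det M\<close>, with eigenvectors the
  symmetric products of \<open>(w\<^sub>1, 1)\<close> and \<open>(w\<^sub>2, 1)\<close>; the mixed product is a multiple of the
  \<open>Q\<close>-cross product of the other two.
\<close>

section \<open>Words in the generators as symmetric squares\<close>

text \<open>\<open>sym_vec (p\<^sup>2) (p q) (q\<^sup>2)\<close> is the null vector
  \<open>(m\<^sup>2 - n\<^sup>2, 2 m n, m\<^sup>2 + n\<^sup>2)\<close> for \<open>m = p + q\<close>, \<open>n = q\<close>. With this shift the three generators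
  come from matrices with nonnegative entries.\<close>

definition sym_vec :: "real \<Rightarrow> real \<Rightarrow> real \<Rightarrow> real vec" where
  "sym_vec x y z = vec_of_list [x + 2 * y, 2 * y + 2 * z, x + 2 * y + 2 * z]"

lemma vec3_eq_iff:
  "vec_of_list [a, b, c] = vec_of_list [a', b', c'] \<longleftrightarrow> a = a' \<and> b = b' \<and> c = c'"
  by (metis list.inject list_vec)

lemma vec3_index [simp]:
  "vec_of_list [a, b, c] $ 0 = a" "vec_of_list [a, b, c] $ Suc 0 = b" "vec_of_list [a, b, c] $ 2 = c"
  "dim_vec (vec_of_list [a, b, c]) = 3"
  by (simp_all add: numeral_2_eq_2 numeral_3_eq_3 vec_of_list_index del: vec_of_list_Cons)

lemma vec3_cases:
  assumes "v \<in> carrier_vec 3"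
  obtains a b c where "v = vec_of_list [a, b, c]"
proof
  show "v = vec_of_list [v $ 0, v $ 1, v $ 2]"
  proof (rule eq_vecI)
    fix i assume "i < dim_vec (vec_of_list [v $ 0, v $ 1, v $ 2])"
    then have "i = 0 \<or> i = Suc 0 \<or> i = 2"
      by (auto simp del: vec_of_list_Cons)
    then show "v $ i = vec_of_list [v $ 0, v $ 1, v $ 2] $ i"
      by (auto simp del: vec_of_list_Cons)
  qed (use assms in \<open>auto simp del: vec_of_list_Cons\<close>)
qed

lemma smult_vec3: "k \<cdot>\<^sub>v vec_of_list [a, b, c] = vec_of_list [k * a, k * b, k * (c::real)]"
  by (rule eq_vecI) (auto simp: vec_of_list_index nth_Cons' simp del: vec_of_list_Cons)

lemma sym_vec_eq_iff: "sym_vec x y z = sym_vec x' y' z' \<longleftrightarrow> x = x' \<and> y = y' \<and> z = z'"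
  unfolding sym_vec_def vec3_eq_iff by auto

lemma sym_vec_carrier: "sym_vec x y z \<in> carrier_vec 3"
  unfolding sym_vec_def carrier_vec_def by (simp del: vec_of_list_Cons)

text \<open>\<open>sym_vec\<close> is an invertible change of coordinates on all of real 3-space, so
  eigenvectors of \<open>M\<close> that are not known to be null can also be studied in these
  coordinates.\<close>

lemma sym_vec_cases:
  assumes "v \<in> carrier_vec 3"
  obtains x y z where "v = sym_vec x y z"
proof -
  obtain a b c where v: "v = vec_of_list [a, b, c]"
    using vec3_cases[OF assms] .
  have "v = sym_vec (c - b) ((a + b - c) / 2) ((c - a) / 2)"
    unfolding v sym_vec_def vec3_eq_iff by (simp add: field_simps)
  then show thesis using that by blast
qed

lemma smult_sym_vec: "k \<cdot>\<^sub>v sym_vec x y z = sym_vec (k * x) (k * y) (k * z)"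
  unfolding sym_vec_def smult_vec3 vec3_eq_iff by (simp add: algebra_simps)

lemma sym_vec_eq_0_iff: "sym_vec x y z = 0\<^sub>v 3 \<longleftrightarrow> x = 0 \<and> y = 0 \<and> z = 0"
proof -
  have "0\<^sub>v 3 = 0 \<cdot>\<^sub>v sym_vec 0 0 0"
    using sym_vec_carrier[of 0 0 0] by auto
  then show ?thesis
    by (simp add: smult_sym_vec sym_vec_eq_iff)
qed

section \<open>The generators and their action on symmetric squares\<close>

lemma mat_of_rows_list3_mult_vec:
  "mat_of_rows_list 3 [[a11, a12, a13], [a21, a22, a23], [a31, a32, a33]] *\<^sub>v vec_of_list [x, y, z] =
   vec_of_list [a11 * x + a12 * y + a13 * z, a21 * x + a22 * y + a23 * z,
     a31 * x + a32 * y + a33 * (z::real)]"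
  by (rule eq_vecI)
     (auto simp: vec_of_list_index nth_Cons' mat_of_rows_list_def scalar_prod_def
        numeral_2_eq_2 numeral_3_eq_3 less_Suc_eq simp del: vec_of_list_Cons)

lemma det_mat_of_rows_list3:
  "det (mat_of_rows_list 3 [[a11, a12, a13], [a21, a22, a23], [a31, a32, a33]]) =
   a11 * (a22 * a33 - a23 * a32) - a12 * (a21 * a33 - a23 * a31)
     + a13 * (a21 * a32 - a22 * (a31::real))" (is "det ?A = _")
proof -
  have two: "det B = B $$ (0,0) * B $$ (1,1) - B $$ (0,1) * B $$ (1,0)"
    if B: "B \<in> carrier_mat 2 2" for B :: "real mat"
  proof -
    have "det B = (\<Sum>j<2. B $$ (0, j) * cofactor B 0 j)"
      using laplace_expansion_row[OF B, of 0] by simp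
    also have "\<dots> = B $$ (0,0) * B $$ (1,1) - B $$ (0,1) * B $$ (1,0)"
      using B by (simp add: numeral_2_eq_2 cofactor_def det_single mat_delete_def)
    finally show ?thesis .
  qed
  have A: "?A \<in> carrier_mat 3 3"
    by (simp add: mat_of_rows_list_def numeral_3_eq_3)
  have minor: "mat_delete ?A 0 j \<in> carrier_mat 2 2" for j
    by (simp add: mat_of_rows_list_def mat_delete_def numeral_2_eq_2)
  have "det ?A = (\<Sum>j<3. ?A $$ (0, j) * cofactor ?A 0 j)"
    using laplace_expansion_row[OF A, of 0] by simp
  also have "\<dots> = a11 * (a22 * a33 - a23 * a32) - a12 * (a21 * a33 - a23 * a31)
     + a13 * (a21 * a32 - a22 * a31)"
    unfolding cofactor_def two[OF minor]
    by (simp add: numeral_3_eq_3 numeral_2_eq_2 mat_delete_def mat_of_rows_list_def algebra_simps)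
  finally show ?thesis .
qed

lemma gen_mat_carrier: "gen_mat d \<in> carrier_mat 3 3"
  by (simp add: gen_mat_def mat_of_rows_list_def numeral_3_eq_3)

lemma det_gen_mat: "det (gen_mat 1) = 1" "det (gen_mat 2) = -1" "det (gen_mat 3) = 1"
  by (simp_all add: gen_mat_def det_mat_of_rows_list3)

lemma gen_mat_mult_sym_vec:
  "gen_mat 1 *\<^sub>v sym_vec x y z = sym_vec (x + 4 * y + 4 * z) (y + 2 * z) z"
  "gen_mat 2 *\<^sub>v sym_vec x y z = sym_vec (x + 4 * y + 4 * z) (x + 3 * y + 2 * z) (x + 2 * y + z)"
  "gen_mat 3 *\<^sub>v sym_vec x y z = sym_vec x (x + y) (x + 2 * y + z)"
  by (simp_all add: gen_mat_def sym_vec_def mat_of_rows_list3_mult_vec vec3_eq_iff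
        del: vec_of_list_Cons)

lemma word_mat_Cons: "word_mat (d # ds) = gen_mat d * word_mat ds"
  by (simp add: word_mat_def)

lemma word_mat_carrier: "word_mat ds \<in> carrier_mat 3 3"
  by (induction ds) (auto simp: word_mat_Cons intro!: mult_carrier_mat[OF gen_mat_carrier],
    simp add: word_mat_def)

text \<open>\<open>M\<close> acts on the products \<open>(p\<^sup>2, p q, q\<^sup>2)\<close> as the substitution
  \<open>(p, q) \<mapsto> (a p + b q, c p + d q)\<close>.\<close>

definition symmetric_square :: "real mat \<Rightarrow> real \<Rightarrow> real \<Rightarrow> real \<Rightarrow> real \<Rightarrow> bool" where
  "symmetric_square M a b c d \<longleftrightarrow> M \<in> carrier_mat 3 3 \<and> (\<forall>x y z. M *\<^sub>v sym_vec x y z =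
     sym_vec (a\<^sup>2 * x + 2 * a * b * y + b\<^sup>2 * z) (a * c * x + (a * d + b * c) * y + b * d * z)
       (c\<^sup>2 * x + 2 * c * d * y + d\<^sup>2 * z))"

text \<open>The symmetric square is functorial: substitutions compose, and the new coefficients are
  the entries of the product of the two 2 by 2 matrices.\<close>

lemma symmetric_square_mult:
  assumes "symmetric_square M a b c d" "symmetric_square M' a' b' c' d'"
  shows "symmetric_square (M * M')
    (a * a' + b * c') (a * b' + b * d') (c * a' + d * c') (c * b' + d * d')"
proof -
  have carrier: "M \<in> carrier_mat 3 3" "M' \<in> carrier_mat 3 3"
    using assms by (simp_all add: symmetric_square_def)
  have "(M * M') *\<^sub>v sym_vec x y z = M *\<^sub>v (M' *\<^sub>v sym_vec x y z)" for x y z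
    by (rule assoc_mult_mat_vec[OF carrier sym_vec_carrier])
  then show ?thesis
    using assms mult_carrier_mat[OF carrier]
    by (simp add: symmetric_square_def sym_vec_eq_iff) (simp add: power2_eq_square algebra_simps)
qed

lemma symmetric_square_gen_mat:
  "symmetric_square (gen_mat 1) 1 2 0 1"
  "symmetric_square (gen_mat 2) 1 2 1 1"
  "symmetric_square (gen_mat 3) 1 0 1 1"
  unfolding symmetric_square_def gen_mat_mult_sym_vec sym_vec_eq_iff
  by (simp_all add: gen_mat_carrier)

text \<open>Prepending 1 or 2 adds a positive multiple of \<open>d\<close> to \<open>b\<close>, and
  prepending 2 or 3 adds \<open>a\<close> to \<open>c\<close>. As \<open>a\<close> and
  \<open>d\<close> stay at least 1 and no entry decreases, one letter other than 3 makes
  \<open>b\<close> positive for good, and one letter other than 1 does so for \<open>c\<close>. The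
  determinants of the 2 by 2 and of the 3 by 3 generators agree, which keeps the two determinants of
  the word equal.\<close>

lemma word_mat_symmetric_square:
  assumes "set ds \<subseteq> {1, 2, 3}"
  shows "\<exists>(a::int) (b::int) (c::int) (d::int). 1 \<le> a \<and> 0 \<le> b \<and> 0 \<le> c \<and> 1 \<le> d \<and>
    ((\<exists>i\<in>set ds. i \<noteq> 1) \<longrightarrow> 0 < c) \<and> ((\<exists>i\<in>set ds. i \<noteq> 3) \<longrightarrow> 0 < b) \<and>
    a * d - b * c \<in> {1, -1} \<and> det (word_mat ds) = of_int (a * d - b * c) \<and>
    symmetric_square (word_mat ds) (of_int a) (of_int b) (of_int c) (of_int d)"
  using assms
proof (induction ds)
  case Nil
  have "symmetric_square (word_mat []) 1 0 0 1"
    by (simp add: symmetric_square_def word_mat_def sym_vec_carrier)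
  then show ?case
    by (intro exI[of _ 1] exI[of _ 0]) (simp add: word_mat_def)
next
  case (Cons i ds)
  then have "set ds \<subseteq> {1, 2, 3}" by simp
  from Cons.IH[OF this] obtain a b c d :: int where
    pos: "1 \<le> a" "0 \<le> b" "0 \<le> c" "1 \<le> d"
    and c: "(\<exists>i\<in>set ds. i \<noteq> 1) \<longrightarrow> 0 < c" and b: "(\<exists>i\<in>set ds. i \<noteq> 3) \<longrightarrow> 0 < b"
    and unit: "a * d - b * c \<in> {1, -1}"
    and det: "det (word_mat ds) = of_int (a * d - b * c)"
    and sq: "symmetric_square (word_mat ds) (of_int a) (of_int b) (of_int c) (of_int d)"
    by (elim exE conjE) (rule that)
  have det': "det (word_mat (i # ds)) = det (gen_mat i) * of_int (a * d - b * c)"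
    unfolding word_mat_Cons det_mult[OF gen_mat_carrier word_mat_carrier] det by simp
  have "i = 1 \<or> i = 2 \<or> i = 3" using Cons.prems by simp
  then show ?case
  proof (elim disjE)
    assume i: "i = 1"
    have "(a + 2 * c) * d - (b + 2 * d) * c = a * d - b * c"
      by (simp add: algebra_simps)
    moreover have "symmetric_square (word_mat (i # ds)) (of_int (a + 2 * c)) (of_int (b + 2 * d))
        (of_int c) (of_int d)"
      using symmetric_square_mult[OF symmetric_square_gen_mat(1) sq] by (simp add: i word_mat_Cons)
    moreover have "(\<exists>i\<in>set (i # ds). i \<noteq> 1) \<longrightarrow> 0 < c"
      using i c by simp
    ultimately show ?thesis
      using pos unit det' unfolding i det_gen_mat
      by (intro exI[of _ "a + 2 * c"] exI[of _ "b + 2 * d"] exI[of _ c] exI[of _ d] conjI) simp_all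
  next
    assume i: "i = 2"
    have "(a + 2 * c) * (b + d) - (b + 2 * d) * (a + c) = - (a * d - b * c)"
      by (simp add: algebra_simps)
    moreover have "symmetric_square (word_mat (i # ds)) (of_int (a + 2 * c)) (of_int (b + 2 * d))
        (of_int (a + c)) (of_int (b + d))"
      using symmetric_square_mult[OF symmetric_square_gen_mat(2) sq] by (simp add: i word_mat_Cons)
    ultimately show ?thesis
      using pos unit det' unfolding i det_gen_mat
      by (intro exI[of _ "a + 2 * c"] exI[of _ "b + 2 * d"] exI[of _ "a + c"] exI[of _ "b + d"] conjI)
         auto
  next
    assume i: "i = 3"
    have "a * (b + d) - b * (a + c) = a * d - b * c"
      by (simp add: algebra_simps)
    moreover have "symmetric_square (word_mat (i # ds)) (of_int a) (of_int b)
        (of_int (a + c)) (of_int (b + d))"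
      using symmetric_square_mult[OF symmetric_square_gen_mat(3) sq] by (simp add: i word_mat_Cons)
    moreover have "(\<exists>i\<in>set (i # ds). i \<noteq> 3) \<longrightarrow> 0 < b"
      using i b by simp
    ultimately show ?thesis
      using pos unit det' unfolding i det_gen_mat
      by (intro exI[of _ a] exI[of _ b] exI[of _ "a + c"] exI[of _ "b + d"] conjI) simp_all
  qed
qed

section \<open>Real quadratic fields\<close>

text \<open>Writing the root in lowest terms as m/n gives D n^2 = m^2, so n divides m and therefore
  n = 1.\<close>

lemma int_sqrt_Rats_is_square:
  fixes D :: int
  assumes "sqrt (of_int D) \<in> \<rat>" "0 \<le> D"
  obtains k where "D = k\<^sup>2" "0 \<le> k"
proof -
  obtain m n :: nat where "n \<noteq> 0" and mn: "\<bar>sqrt (of_int D)\<bar> = m / n" and co: "coprime m n"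
    using Rats_abs_nat_div_natE[OF assms(1)] by metis
  have "real_of_int D * (real n)\<^sup>2 = (real m)\<^sup>2"
  proof -
    have "real_of_int D = (\<bar>sqrt (of_int D)\<bar>)\<^sup>2"
      using assms(2) by simp
    then show ?thesis
      unfolding mn using \<open>n \<noteq> 0\<close> by (simp add: power_divide)
  qed
  then have eq: "D * (int n)\<^sup>2 = (int m)\<^sup>2"
    by (metis of_int_eq_iff of_int_mult of_int_of_nat_eq of_int_power)
  then have "(int n)\<^sup>2 dvd (int m)\<^sup>2"
    by (metis dvd_triv_right)
  then have "n dvd m"
    by simp
  with co have "n = 1"
    by (metis coprime_absorb_right nat_dvd_1_iff_1)
  then show thesis
    using eq that[of "int m"] by simp
qed

definition quad_field :: "real \<Rightarrow> real set" where
  "quad_field s = {x + y * s | x y. x \<in> \<rat> \<and> y \<in> \<rat>}"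

text \<open>For irrational \<open>s\<close> this is the Galois conjugation on \<open>quad_field s\<close>, and unspecified outside.\<close>

definition quad_conj :: "real \<Rightarrow> real \<Rightarrow> real" where
  "quad_conj s z = (THE u. \<exists>x\<in>\<rat>. \<exists>y\<in>\<rat>. z = x + y * s \<and> u = x - y * s)"

lemma quad_field_iff: "z \<in> quad_field s \<longleftrightarrow> (\<exists>x\<in>\<rat>. \<exists>y\<in>\<rat>. z = x + y * s)"
  unfolding quad_field_def by auto

lemma Rats_in_quad_field: "x \<in> \<rat> \<Longrightarrow> x \<in> quad_field s"
  unfolding quad_field_iff by (rule bexI[of _ x], rule bexI[of _ 0]) auto

section \<open>The reals as an algebraic structure with explicit operations\<close>

lemma real_ring_simps:
  "carrier real_ring = UNIV" "\<zero>\<^bsub>real_ring\<^esub> = 0" "\<one>\<^bsub>real_ring\<^esub> = 1"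
    "x \<oplus>\<^bsub>real_ring\<^esub> y = x + y" "x \<otimes>\<^bsub>real_ring\<^esub> y = x * y"
  by (simp_all add: ring_of_type_algebra_def)

lemma field_real_ring: "Ring.field real_ring"
  by (rule field_from_type_algebra)

lemma real_ring_minus: "\<ominus>\<^bsub>real_ring\<^esub> x = - x"
proof -
  interpret R: field real_ring by (rule field_real_ring)
  show ?thesis
    by (rule R.minus_equality) (simp_all only: real_ring_simps, simp_all)
qed

lemma real_ring_inv: "x \<noteq> 0 \<Longrightarrow> inv\<^bsub>real_ring\<^esub> x = inverse x"
proof -
  assume "x \<noteq> 0"
  interpret R: field real_ring by (rule field_real_ring)
  show ?thesis
    by (rule R.comm_inv_char) (simp_all only: real_ring_simps UNIV_I, simp_all add: \<open>x \<noteq> 0\<close>)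
qed

section \<open>Arithmetic and conjugation in the field generated by a quadratic irrational\<close>

locale quadratic_irrational =
  fixes s :: real
  assumes irrational: "s \<notin> \<rat>" and square_rational: "s\<^sup>2 \<in> \<rat>"
begin

text \<open>Different coefficients of \<open>s\<close> would express \<open>s\<close> as a quotient
  of rationals. This uniqueness is what makes the description in \<open>quad_conj\<close> well
  defined.\<close>

lemma coeffs_unique:
  assumes "x \<in> \<rat>" "y \<in> \<rat>" "x' \<in> \<rat>" "y' \<in> \<rat>" "x + y * s = x' + y' * s"
  shows "x = x'" "y = y'"
proof -
  show "y = y'"
  proof (rule ccontr)
    assume "y \<noteq> y'"
    then have "s = (x' - x) / (y - y')"
      using assms(5) by (simp add: field_simps)
    then show False
      using assms irrational by (metis Rats_diff Rats_divide)
  qed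
  then show "x = x'" using assms(5) by simp
qed

lemma conj_eq:
  assumes "x \<in> \<rat>" "y \<in> \<rat>"
  shows "quad_conj s (x + y * s) = x - y * s"
  unfolding quad_conj_def
proof (rule the_equality)
  show "\<exists>x'\<in>\<rat>. \<exists>y'\<in>\<rat>. x + y * s = x' + y' * s \<and> x - y * s = x' - y' * s"
    using assms by blast
next
  fix u assume "\<exists>x'\<in>\<rat>. \<exists>y'\<in>\<rat>. x + y * s = x' + y' * s \<and> u = x' - y' * s"
  then obtain x' y' where *: "x' \<in> \<rat>" "y' \<in> \<rat>" "x + y * s = x' + y' * s" "u = x' - y' * s"
    by blast
  then show "u = x - y * s"
    using coeffs_unique[OF assms *(1,2,3)] by simp
qed

lemma conj_Rats: "x \<in> \<rat> \<Longrightarrow> quad_conj s x = x"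
  using conj_eq[of x 0] by simp

lemma root_in_field: "s \<in> quad_field s"
  unfolding quad_field_iff by (rule bexI[of _ 0], rule bexI[of _ 1]) auto

lemma conj_root: "quad_conj s s = - s"
  using conj_eq[of 0 1] by simp

lemma add_closed: "u \<in> quad_field s \<Longrightarrow> v \<in> quad_field s \<Longrightarrow> u + v \<in> quad_field s"
  and conj_add: "u \<in> quad_field s \<Longrightarrow> v \<in> quad_field s \<Longrightarrow>
    quad_conj s (u + v) = quad_conj s u + quad_conj s v"
proof -
  assume "u \<in> quad_field s" "v \<in> quad_field s"
  then obtain x y x' y' where r: "x \<in> \<rat>" "y \<in> \<rat>" "x' \<in> \<rat>" "y' \<in> \<rat>"
    and uv: "u = x + y * s" "v = x' + y' * s"
    unfolding quad_field_iff by blast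
  have sum: "u + v = (x + x') + (y + y') * s"
    unfolding uv by (simp add: algebra_simps)
  then show "u + v \<in> quad_field s"
    unfolding quad_field_iff using r by (meson Rats_add)
  show "quad_conj s (u + v) = quad_conj s u + quad_conj s v"
    unfolding sum conj_eq[OF Rats_add[OF r(1,3)] Rats_add[OF r(2,4)]]
    unfolding uv conj_eq[OF r(1,2)] conj_eq[OF r(3,4)] by (simp add: algebra_simps)
qed

lemma mult_closed: "u \<in> quad_field s \<Longrightarrow> v \<in> quad_field s \<Longrightarrow> u * v \<in> quad_field s"
  and conj_mult: "u \<in> quad_field s \<Longrightarrow> v \<in> quad_field s \<Longrightarrow>
    quad_conj s (u * v) = quad_conj s u * quad_conj s v"
proof -
  assume "u \<in> quad_field s" "v \<in> quad_field s"
  then obtain x y x' y' where r: "x \<in> \<rat>" "y \<in> \<rat>" "x' \<in> \<rat>" "y' \<in> \<rat>"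
    and uv: "u = x + y * s" "v = x' + y' * s"
    unfolding quad_field_iff by blast
  have prod: "u * v = (x * x' + y * y' * s\<^sup>2) + (x * y' + y * x') * s"
    unfolding uv by (simp add: algebra_simps power2_eq_square)
  have r': "x * x' + y * y' * s\<^sup>2 \<in> \<rat>" "x * y' + y * x' \<in> \<rat>"
    using r square_rational by (auto intro: Rats_add Rats_mult)
  show "u * v \<in> quad_field s"
    unfolding quad_field_iff using prod r' by blast
  show "quad_conj s (u * v) = quad_conj s u * quad_conj s v"
    unfolding prod conj_eq[OF r']
    unfolding uv conj_eq[OF r(1,2)] conj_eq[OF r(3,4)]
    by (simp add: algebra_simps power2_eq_square)
qed

lemma minus_closed: "u \<in> quad_field s \<Longrightarrow> - u \<in> quad_field s"
  using mult_closed[of "-1" u] Rats_in_quad_field[of "-1" s] by simp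

lemma conj_closed: "u \<in> quad_field s \<Longrightarrow> quad_conj s u \<in> quad_field s"
proof -
  assume "u \<in> quad_field s"
  then obtain x y where r: "x \<in> \<rat>" "y \<in> \<rat>" "u = x + y * s"
    unfolding quad_field_iff by blast
  then have "quad_conj s u = x + (- y) * s"
    using conj_eq[of x y] by simp
  then show ?thesis
    unfolding quad_field_iff using r Rats_minus_iff by blast
qed

lemma conj_conj: "u \<in> quad_field s \<Longrightarrow> quad_conj s (quad_conj s u) = u"
proof -
  assume "u \<in> quad_field s"
  then obtain x y where r: "x \<in> \<rat>" "y \<in> \<rat>" "u = x + y * s"
    unfolding quad_field_iff by blast
  then show ?thesis
    using conj_eq[of x y] conj_eq[of x "- y"] by simp
qed

text \<open>The denominator is rationalised: \<open>u\<close> times its conjugate is a rational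
  norm, and the conjugate of a nonzero element is nonzero because 1 and \<open>s\<close> are
  independent over the rationals.\<close>

lemma inverse_closed: "u \<in> quad_field s \<Longrightarrow> inverse u \<in> quad_field s"
proof (cases "u = 0")
  case False
  assume u: "u \<in> quad_field s"
  then obtain x y where r: "x \<in> \<rat>" "y \<in> \<rat>" and u_eq: "u = x + y * s"
    unfolding quad_field_iff by blast
  have norm: "u * (x - y * s) = x\<^sup>2 - y\<^sup>2 * s\<^sup>2"
    unfolding u_eq by (simp add: algebra_simps power2_eq_square)
  have "x - y * s \<noteq> 0"
  proof
    assume "x - y * s = 0"
    then have "x = 0" "y = 0"
      using coeffs_unique[of x "- y" 0 0] r by auto
    with False u_eq show False by simp
  qed
  then have "inverse u = inverse (x\<^sup>2 - y\<^sup>2 * s\<^sup>2) * (x - y * s)"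
    using False unfolding norm[symmetric] by (simp add: field_simps)
  moreover have "inverse (x\<^sup>2 - y\<^sup>2 * s\<^sup>2) \<in> \<rat>"
    using r square_rational by simp
  moreover have "x - y * s \<in> quad_field s"
    using conj_closed[OF u] conj_eq[OF r] u_eq by simp
  ultimately show ?thesis
    using mult_closed Rats_in_quad_field by metis
qed (metis Rats_0 Rats_in_quad_field inverse_zero)

lemma divide_closed: "u \<in> quad_field s \<Longrightarrow> v \<in> quad_field s \<Longrightarrow> u / v \<in> quad_field s"
  using mult_closed[OF _ inverse_closed] by (simp only: divide_inverse)

lemma conj_divide:
  assumes "u \<in> quad_field s" "v \<in> quad_field s" "v \<noteq> 0"
  shows "quad_conj s (u / v) = quad_conj s u / quad_conj s v"
proof -
  have "quad_conj s v \<noteq> 0"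
    using conj_conj[OF assms(2)] conj_Rats[OF Rats_0] assms(3) by metis
  moreover have "quad_conj s (u / v) * quad_conj s v = quad_conj s u"
    using conj_mult[OF divide_closed[OF assms(1,2)] assms(2)] assms(3)
    by (metis nonzero_divide_eq_eq)
  ultimately show ?thesis
    by (metis nonzero_eq_divide_eq)
qed

lemma real_quadratic_field_quad_field: "real_quadratic_field (quad_field s)"
proof -
  interpret R: field real_ring by (rule field_real_ring)
  have "subring (quad_field s) real_ring"
  proof (rule R.subringI, unfold real_ring_simps real_ring_minus)
    show "1 \<in> quad_field s"
      by (rule Rats_in_quad_field) (rule Rats_1)
  qed (auto intro: minus_closed mult_closed add_closed)
  then have "subfield (quad_field s) real_ring"
  proof (rule R.subfieldI')
    fix k assume "k \<in> quad_field s - {\<zero>\<^bsub>real_ring\<^esub>}"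
    then show "inv\<^bsub>real_ring\<^esub> k \<in> quad_field s"
      using real_ring_inv[of k] inverse_closed[of k] unfolding real_ring_simps by force
  qed
  moreover have "R.dimension 2 \<rat> (quad_field s)"
  proof -
    \<comment> \<open>The dimension is counted by adjoining one vector at a time: 1 extends the zero
      space to the rationals, and \<open>s\<close>, lying outside the rationals, extends these to
      the whole field.\<close>
    have "R.line_extension \<rat> 1 {0} = \<rat>"
      unfolding set_eq_iff R.line_extension_mem_iff real_ring_simps by force
    then have one: "R.dimension 1 \<rat> \<rat>"
      using R.Suc_dim[OF _ _ R.zero_dim, of 1 \<rat>] unfolding real_ring_simps by force
    have "R.line_extension \<rat> s \<rat> = quad_field s"
      unfolding set_eq_iff R.line_extension_mem_iff real_ring_simps quad_field_iff
      by (metis add.commute)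
    then show ?thesis
      using R.Suc_dim[OF _ irrational one] unfolding real_ring_simps Suc_1 by simp
  qed
  ultimately show ?thesis
    unfolding real_quadratic_field_def by blast
qed

lemma nontrivial_automorphism_quad_conj:
  "nontrivial_automorphism (quad_field s) (quad_conj s)"
proof -
  have "quad_conj s \<in> ring_iso (real_ring\<lparr>carrier := quad_field s\<rparr>)
      (real_ring\<lparr>carrier := quad_field s\<rparr>)"
    unfolding ring_iso_def
  proof (intro CollectI conjI ring_hom_memI)
    show "bij_betw (quad_conj s) (carrier (real_ring\<lparr>carrier := quad_field s\<rparr>))
        (carrier (real_ring\<lparr>carrier := quad_field s\<rparr>))"
      by (rule bij_betw_byWitness[where f' = "quad_conj s"]) (auto simp: conj_conj conj_closed)
  qed (simp_all add: real_ring_simps conj_closed conj_mult conj_add conj_Rats)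
  moreover have "quad_conj s s \<noteq> s"
    using irrational by (auto simp: conj_root)
  ultimately show ?thesis
    unfolding nontrivial_automorphism_def using conj_Rats root_in_field by blast
qed

end

section \<open>Eigenvectors of a symmetric square\<close>

text \<open>The hypotheses say that (w, 1) and (w', 1) are eigenvectors of the 2 by 2 matrix for
  \<open>m\<close> and \<open>m'\<close>. The vector is \<open>k\<close> times their symmetric
  product, and each factor contributes its own eigenvalue. Taking w = w' gives the null
  eigenvectors, and w different from w' the mixed one.\<close>

lemma symmetric_square_eigenvector:
  assumes "symmetric_square M a b c d"
    and "a * w + b = m * w" "c * w + d = m" "a * w' + b = m' * w'" "c * w' + d = m'" "k \<noteq> 0"
  shows "eigenvector M (sym_vec (k * (w * w')) (k * ((w + w') / 2)) k) (m * m')"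
proof -
  have "a\<^sup>2 * (k * (w * w')) + 2 * a * b * (k * ((w + w') / 2)) + b\<^sup>2 * k
      = k * ((a * w + b) * (a * w' + b))"
    by (simp add: field_simps power2_eq_square)
  moreover have "a * c * (k * (w * w')) + (a * d + b * c) * (k * ((w + w') / 2)) + b * d * k
      = k * (((a * w + b) * (c * w' + d) + (a * w' + b) * (c * w + d)) / 2)"
    by (simp add: field_simps)
  moreover have "c\<^sup>2 * (k * (w * w')) + 2 * c * d * (k * ((w + w') / 2)) + d\<^sup>2 * k
      = k * ((c * w + d) * (c * w' + d))"
    by (simp add: field_simps power2_eq_square)
  ultimately have "M *\<^sub>v sym_vec (k * (w * w')) (k * ((w + w') / 2)) k
      = (m * m') \<cdot>\<^sub>v sym_vec (k * (w * w')) (k * ((w + w') / 2)) k"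
    using assms(1) unfolding symmetric_square_def smult_sym_vec assms(2-5)
    by (simp add: sym_vec_eq_iff field_simps)
  then show ?thesis
    using assms(1,6) sym_vec_carrier
    by (auto simp: eigenvector_def symmetric_square_def sym_vec_eq_0_iff)
qed

text \<open>The form \<open>x - (u + u') y + u u' z\<close> is the polarisation of \<open>(p - u q) (p - u' q)\<close>, a product
  of two left eigenvectors of the \<open>2 \<times> 2\<close> matrix.\<close>

lemma symmetric_square_dual_eigenvector:
  assumes "symmetric_square M a b c d" "M *\<^sub>v sym_vec x y z = l \<cdot>\<^sub>v sym_vec x y z"
    and "a - c * u = m" "b - d * u = - (m * u)" "a - c * u' = m'" "b - d * u' = - (m' * u')"
    and "l \<noteq> m * m'"
  shows "x - (u + u') * y + u * u' * z = 0"
proof -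
  have eqs: "a\<^sup>2 * x + 2 * a * b * y + b\<^sup>2 * z = l * x"
    "a * c * x + (a * d + b * c) * y + b * d * z = l * y"
    "c\<^sup>2 * x + 2 * c * d * y + d\<^sup>2 * z = l * z"
    using assms(1,2) unfolding symmetric_square_def smult_sym_vec by (simp_all add: sym_vec_eq_iff)
  \<comment> \<open>The form is evaluated on the image of the vector under \<open>M\<close>. The
    eigenvector equation gives the factor \<open>l\<close>, the left eigenvectors give the factor
    \<open>m * m'\<close>, and as these differ the form must vanish.\<close>
  have "l * (x - (u + u') * y + u * u' * z) = l * x - (u + u') * (l * y) + u * u' * (l * z)"
    by (simp add: algebra_simps)
  also have "\<dots> = ((a - c * u) * (a - c * u')) * x
      + ((a - c * u) * (b - d * u') + (a - c * u') * (b - d * u)) * y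
      + ((b - d * u) * (b - d * u')) * z"
    unfolding eqs[symmetric] by (simp add: algebra_simps power2_eq_square)
  also have "\<dots> = (m * m') * (x - (u + u') * y + u * u' * z)"
    unfolding assms(3-6) by (simp add: algebra_simps)
  finally show ?thesis
    using assms(7) by simp
qed

text \<open>With t = a + d, the number lies strictly between consecutive squares: between (t - 1)^2
  and t^2 for determinant 1, where t is at least 3, and between t^2 and (t + 1)^2 for determinant
  -1, where t is at least 2.\<close>

lemma trace_square_minus_4_det_not_square:
  fixes a b c d :: int
  assumes "1 \<le> a" "1 \<le> b" "1 \<le> c" "1 \<le> d" "a * d - b * c \<in> {1, -1}" "0 \<le> k"
  shows "(a + d)\<^sup>2 - 4 * (a * d - b * c) \<noteq> k\<^sup>2"
proof
  assume k: "(a + d)\<^sup>2 - 4 * (a * d - b * c) = k\<^sup>2"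
  define t where "t = a + d"
  have t2: "t \<ge> 2" using assms by (simp add: t_def)
  from assms(5) consider "a * d - b * c = 1" | "a * d - b * c = -1" by blast
  then show False
  proof cases
    case 1
    \<comment> \<open>The trace 2 has to be excluded, since t^2 - 4 would then be the square 0. It
      would force a = d = 1, hence b c = 0.\<close>
    have "b * c \<ge> 1"
      using mult_mono[of 1 b 1 c] assms by simp
    with 1 have "a * d \<noteq> 1" by simp
    then have "\<not> (a = 1 \<and> d = 1)" by auto
    with assms have t3: "t \<ge> 3" by (simp add: t_def) linarith
    from k 1 have eq: "k\<^sup>2 = t\<^sup>2 - 4" by (simp add: t_def)
    then have "k\<^sup>2 < t\<^sup>2" by simp
    then have "k < t"
      using t2 power_less_imp_less_base[of k 2 t] by simp
    then have "k\<^sup>2 \<le> (t - 1)\<^sup>2"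
      using assms(6) by (intro power_mono) auto
    also have "\<dots> = t\<^sup>2 - 2 * t + 1"
      by (simp add: power2_eq_square algebra_simps)
    finally show False
      using eq t3 by simp
  next
    case 2
    from k 2 have eq: "k\<^sup>2 = t\<^sup>2 + 4" by (simp add: t_def)
    then have "t\<^sup>2 < k\<^sup>2" by simp
    then have "t < k"
      using assms(6) power_less_imp_less_base[of t 2 k] by simp
    then have "(t + 1)\<^sup>2 \<le> k\<^sup>2"
      using t2 by (intro power_mono) auto
    moreover have "(t + 1)\<^sup>2 = t\<^sup>2 + 2 * t + 1"
      by (simp add: power2_eq_square algebra_simps)
    ultimately show False
      using eq t2 by simp
  qed
qed

text \<open>\<open>n\<close> is the last coordinate of the null vector built from (w, 1), so
  dividing by it gives the representative of a point. The middle entry is kept as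
  \<open>(w + w) / 2\<close> to fit \<open>symmetric_square_eigenvector\<close>.\<close>

lemma sym_vec_null_point:
  assumes "n = w * w + 2 * w + 2" "n \<noteq> 0"
  shows "vec_of_list [(w * w + 2 * w) / n, (2 * w + 2) / n, 1] =
    sym_vec (1 / n * (w * w)) (1 / n * ((w + w) / 2)) (1 / n)"
proof -
  have "(w * w + 2 * w + 2) / n = 1"
    using assms by simp
  then show ?thesis
    unfolding sym_vec_def vec3_eq_iff by (simp add: add_divide_distrib)
qed

text \<open>For w different from w' both sides are orthogonal to the two null vectors with respect
  to the quadratic form, so they are proportional. The explicit factor shows that the product is
  nonzero in that case.\<close>

lemma Q_cross_null_points:
  assumes n: "n = w * w + 2 * w + 2" "n \<noteq> 0" and n': "n' = w' * w' + 2 * w' + 2" "n' \<noteq> 0"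
  shows "Q_cross (vec_of_list [(w * w + 2 * w) / n, (2 * w + 2) / n, 1])
      (vec_of_list [(w' * w' + 2 * w') / n', (2 * w' + 2) / n', 1]) =
    sym_vec (- 2 * (w - w') / (n * n') * (w * w')) (- 2 * (w - w') / (n * n') * ((w + w') / 2))
      (- 2 * (w - w') / (n * n'))"
proof -
  have e0: "(2 * w + 2) * n' - (2 * w' + 2) * n = - 2 * (w - w') * (w * w' + w + w')"
    and e1: "(w' * w' + 2 * w') * n - (w * w + 2 * w) * n' = - 2 * (w - w') * (w + w' + 2)"
    and e2: "(w' * w' + 2 * w') * (2 * w + 2) - (w * w + 2 * w) * (2 * w' + 2)
      = - 2 * (w - w') * (w * w' + w + w' + 2)"
    unfolding n n' by (simp_all add: algebra_simps)
  have "(2 * w + 2) / n - (2 * w' + 2) / n' = ((2 * w + 2) * n' - (2 * w' + 2) * n) / (n * n')"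
    "(w' * w' + 2 * w') / n' - (w * w + 2 * w) / n
      = ((w' * w' + 2 * w') * n - (w * w + 2 * w) * n') / (n * n')"
    "(w' * w' + 2 * w') / n' * ((2 * w + 2) / n) - (w * w + 2 * w) / n * ((2 * w' + 2) / n')
      = ((w' * w' + 2 * w') * (2 * w + 2) - (w * w + 2 * w) * (2 * w' + 2)) / (n * n')"
    by (simp_all only: diff_frac_eq[OF n(2) n'(2)] diff_frac_eq[OF n'(2) n(2)] mult.commute[of n' n]
        times_divide_times_eq diff_divide_distrib[symmetric])
  note e = this[unfolded e0 e1 e2]
  have sym: "sym_vec (r * (w * w')) (r * ((w + w') / 2)) r = vec_of_list
      [r * (w * w' + w + w'), r * (w + w' + 2), r * (w * w' + w + w' + 2)]" for r
    unfolding sym_vec_def vec3_eq_iff by (simp add: algebra_simps)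
  show ?thesis
    unfolding sym unfolding Q_cross_def One_nat_def vec3_index mult_1_right mult_1_left e
    unfolding times_divide_eq_left ..
qed

section \<open>Eigenvalues and eigenvectors of a word, assembled from the 2 by 2 matrix\<close>

theorem theorem3p7:
  fixes ds :: "nat list" and M :: "real mat"
  assumes "set ds \<subseteq> {1, 2, 3}"
    and "\<not> (\<forall>d\<in>set ds. d = 1)"
    and "\<not> (\<forall>d\<in>set ds. d = 3)"
    and "M = word_mat ds"
  shows "\<exists>K \<sigma>. real_quadratic_field K \<and> nontrivial_automorphism K \<sigma> \<and>
    (\<exists>l\<^sub>1 l\<^sub>2 l\<^sub>3 \<alpha> \<beta> v\<^sub>1 v\<^sub>2 v\<^sub>3.
      eigenvalue M l\<^sub>1 \<and> l\<^sub>1 > 1 \<and> l\<^sub>1 \<in> K \<and>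
      eigenvalue M l\<^sub>2 \<and> l\<^sub>2 = \<sigma> l\<^sub>1 \<and> 0 < l\<^sub>2 \<and> l\<^sub>2 < 1 \<and>
      eigenvalue M l\<^sub>3 \<and> l\<^sub>3 = det M \<and> l\<^sub>3 \<in> {1, -1} \<and>
      spectrum M = {l\<^sub>1, l\<^sub>2, l\<^sub>3} \<and>
      (\<forall>v. eigenvector M v l\<^sub>1 \<longrightarrow> Q_null v \<and> represents v (\<alpha>, \<beta>)) \<and>
      (\<alpha>, \<beta>) \<in> quarter_circle \<and> \<alpha> \<in> K \<and> \<beta> \<in> K \<and>
      v\<^sub>1 = vec_of_list [\<alpha>, \<beta>, 1] \<and> eigenvector M v\<^sub>1 l\<^sub>1 \<and>
      v\<^sub>2 = vec_of_list [\<sigma> \<alpha>, \<sigma> \<beta>, 1] \<and> eigenvector M v\<^sub>2 l\<^sub>2 \<and>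
      v\<^sub>3 = Q_cross v\<^sub>1 v\<^sub>2 \<and> eigenvector M v\<^sub>3 l\<^sub>3)"
proof -
  obtain a' b' c' d' :: int where
    ge: "1 \<le> a'" "0 \<le> b'" "0 \<le> c'" "1 \<le> d'"
    and c': "(\<exists>i\<in>set ds. i \<noteq> 1) \<longrightarrow> 0 < c'" and b': "(\<exists>i\<in>set ds. i \<noteq> 3) \<longrightarrow> 0 < b'"
    and unit: "a' * d' - b' * c' \<in> {1, -1}"
    and det': "det (word_mat ds) = of_int (a' * d' - b' * c')"
    and sq': "symmetric_square (word_mat ds) (of_int a') (of_int b') (of_int c') (of_int d')"
    using word_mat_symmetric_square[OF assms(1)] by (elim exE conjE) (rule that)
  have pos': "1 \<le> b'" "1 \<le> c'"
    using b' c' assms(2,3) by auto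
  define a b c d :: real where "a = of_int a'" and "b = of_int b'" and "c = of_int c'"
    and "d = of_int d'"
  note defs = a_def b_def c_def d_def
  have sq: "symmetric_square M a b c d"
    using sq' unfolding defs assms(4) .
  have det: "det M = a * d - b * c"
    using det' unfolding defs assms(4) by simp
  have pos: "1 \<le> a" "1 \<le> b" "1 \<le> c" "1 \<le> d"
    using ge pos' by (simp_all add: defs)
  have rat: "a \<in> \<rat>" "b \<in> \<rat>" "c \<in> \<rat>" "d \<in> \<rat>"
    by (simp_all add: defs)
  have det_unit: "a * d - b * c \<in> {1, -1}"
  proof -
    have "a * d - b * c = of_int (a' * d' - b' * c')"
      by (simp add: defs)
    moreover have "real_of_int e \<in> {1, -1}" if "e \<in> {1, -1}" for e
      using that by auto
    ultimately show ?thesis using unit by metis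
  qed
  define D where "D = (a' + d')\<^sup>2 - 4 * (a' * d' - b' * c')"
  have D: "real_of_int D = (a + d)\<^sup>2 - 4 * (a * d - b * c)"
    by (simp add: D_def defs)
  \<comment> \<open>In this form the discriminant is visibly positive and larger than (a - d)^2; the
    second fact later makes \<open>w1\<close> positive.\<close>
  have D': "real_of_int D = (a - d)\<^sup>2 + 4 * (b * c)"
    unfolding D by (simp add: power2_eq_square algebra_simps)
  have bc: "1 \<le> b * c"
    using mult_mono[of 1 b 1 c] pos by simp
  have D_pos: "0 < real_of_int D"
    unfolding D' using bc by (simp add: add_nonneg_pos)
  define s where "s = sqrt (real_of_int D)"
  have s2: "s * s = (a + d)\<^sup>2 - 4 * (a * d - b * c)" and s_pos: "0 < s"
    using D_pos D unfolding s_def by simp_all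
  have s_gt: "\<bar>a - d\<bar> < s"
    unfolding s_def D' using bc by (intro real_less_rsqrt) simp
  interpret quadratic_irrational s
  proof
    show "s\<^sup>2 \<in> \<rat>"
      using D_pos by (simp add: s_def)
    show "s \<notin> \<rat>"
    proof
      assume "s \<in> \<rat>"
      then obtain k where "D = k\<^sup>2" "0 \<le> k"
        unfolding s_def using D_pos by (elim int_sqrt_Rats_is_square) auto
      then show False
        using trace_square_minus_4_det_not_square[OF ge(1) pos' ge(4) unit \<open>0 \<le> k\<close>]
        unfolding D_def by (elim notE)
    qed
  qed
  \<comment> \<open>These are the roots of the characteristic polynomial of the 2 by 2 matrix, and
    \<open>w1\<close>, \<open>w2\<close> solve c w + d = m. All are written as a rational plus a
    rational multiple of \<open>s\<close>, so that conjugation can be read off.\<close>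
  define m1 m2 where "m1 = (a + d) / 2 + 1 / 2 * s" and "m2 = (a + d) / 2 - 1 / 2 * s"
  define w1 w2 where "w1 = (a - d) / (2 * c) + 1 / (2 * c) * s"
    and "w2 = (a - d) / (2 * c) - 1 / (2 * c) * s"
  have m_in: "m1 \<in> quad_field s" and conj_m: "quad_conj s m1 = m2"
    and w_in: "w1 \<in> quad_field s" and conj_w: "quad_conj s w1 = w2"
  proof -
    have q: "(a + d) / 2 \<in> \<rat>" "1 / 2 \<in> (\<rat>::real set)" "(a - d) / (2 * c) \<in> \<rat>" "1 / (2 * c) \<in> \<rat>"
      using rat by simp_all
    show "m1 \<in> quad_field s" "w1 \<in> quad_field s"
      unfolding m1_def w1_def quad_field_iff using q by blast+
    show "quad_conj s m1 = m2" "quad_conj s w1 = w2"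
      unfolding m1_def w1_def m2_def w2_def by (rule conj_eq[OF q(1,2)], rule conj_eq[OF q(3,4)])
  qed
  have cw: "c * w1 + d = m1" "c * w2 + d = m2"
    using pos by (simp_all add: w1_def w2_def m1_def m2_def field_simps)
  have m_prod: "m1 * m2 = a * d - b * c"
  proof -
    have "m1 * m2 = ((a + d)\<^sup>2 - s * s) / 4"
      by (simp add: m1_def m2_def field_simps power2_eq_square)
    then show ?thesis by (simp add: s2)
  qed
  have m_sum: "m1 + m2 = a + d"
    by (simp add: m1_def m2_def field_simps)
  \<comment> \<open>The row vector (1, -w2) annihilates (w2, 1), so it is a left eigenvector for the
    other eigenvalue \<open>m1\<close>; likewise (1, -w1) belongs to \<open>m2\<close>.\<close>
  have dual: "a - c * w2 = m1" "a - c * w1 = m2"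
    using cw m_sum by linarith+
  have bw: "b - d * w2 = - (m1 * w2)" "b - d * w1 = - (m2 * w1)"
  proof -
    have "c * (b - d * w2) = c * (- (m1 * w2))" "c * (b - d * w1) = c * (- (m2 * w1))"
    proof -
      have "c * (b - d * w2) + c * (m1 * w2) = c * b + (m1 - d) * (c * w2)"
        "c * (b - d * w1) + c * (m2 * w1) = c * b + (m2 - d) * (c * w1)"
        by (simp_all add: algebra_simps)
      moreover have "c * w2 = m2 - d" "c * w1 = m1 - d"
        using cw by simp_all
      \<comment> \<open>This is the characteristic polynomial evaluated at \<open>d\<close>.\<close>
      moreover have "c * b + (m1 - d) * (m2 - d) = 0"
      proof -
        have "c * b + (m1 - d) * (m2 - d) = c * b + m1 * m2 - d * (m1 + m2) + d * d"
          by (simp add: algebra_simps)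
        also note m_sum
        finally show ?thesis
          unfolding m_prod by (simp add: algebra_simps)
      qed
      ultimately show "c * (b - d * w2) = c * (- (m1 * w2))" "c * (b - d * w1) = c * (- (m2 * w1))"
        by (simp_all add: mult.commute)
    qed
    moreover have "c \<noteq> 0" using pos by simp
    ultimately show "b - d * w2 = - (m1 * w2)" "b - d * w1 = - (m2 * w1)"
      by (metis mult_left_cancel)+
  qed
  have aw: "a * w1 + b = m1 * w1" "a * w2 + b = m2 * w2"
  proof -
    have "a * w1 + b = m2 * w1 + (c * w1 + d) * w1 - d * w1 + b"
      by (simp add: algebra_simps flip: dual(2))
    then show "a * w1 + b = m1 * w1"
      using bw(2) cw(1) by simp
    have "a * w2 + b = m1 * w2 + (c * w2 + d) * w2 - d * w2 + b"
      by (simp add: algebra_simps flip: dual(1))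
    then show "a * w2 + b = m2 * w2"
      using bw(1) cw(2) by simp
  qed
  have w1_pos: "0 < w1"
  proof -
    have "w1 = (a - d + s) / (2 * c)"
      by (simp add: w1_def add_divide_distrib)
    then show ?thesis
      using s_gt pos by simp
  qed
  have w_neq: "w1 \<noteq> w2"
    using s_pos pos by (simp add: w1_def w2_def)
  have m1_gt: "1 < m1"
    using s_pos pos by (simp add: m1_def field_simps)
  have l1_gt: "1 < m1 * m1"
    using m1_gt mult_strict_mono[of 1 m1 1 m1] by simp
  have l_prod: "(m1 * m1) * (m2 * m2) = 1"
  proof -
    have "(m1 * m1) * (m2 * m2) = (m1 * m2) * (m1 * m2)"
      by (simp add: algebra_simps)
    then show ?thesis
      unfolding m_prod using det_unit by auto
  qed
  moreover have "m1 * m1 \<noteq> 0"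
    using l1_gt by linarith
  ultimately have l2: "m2 * m2 = 1 / (m1 * m1)"
    by (metis eq_divide_eq mult.commute)
  have l2_pos: "0 < m2 * m2" and l2_lt: "m2 * m2 < 1"
    unfolding l2 using l1_gt by (simp_all del: mult_less_0_iff zero_less_mult_iff)
  have l_neq: "m1 * m1 \<noteq> m2 * m2" "m1 * m1 \<noteq> m2 * m1"
    using l1_gt l2_lt det_unit m_prod by (auto simp: mult.commute)
  define n1 n2 where "n1 = w1 * w1 + 2 * w1 + 2" and "n2 = w2 * w2 + 2 * w2 + 2"
  \<comment> \<open>Completing the square gives positivity whatever the sign of
    \<open>w2\<close>.\<close>
  have n_sq: "n1 = (w1 + 1)\<^sup>2 + 1" "n2 = (w2 + 1)\<^sup>2 + 1"
    by (simp_all add: n1_def n2_def power2_eq_square algebra_simps)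
  have n_pos: "0 < n1" "0 < n2"
    unfolding n_sq by (simp_all add: add_nonneg_pos)
  define \<alpha> \<beta> where "\<alpha> = (w1 * w1 + 2 * w1) / n1" and "\<beta> = (2 * w1 + 2) / n1"
  have two_in: "2 \<in> quad_field s"
    by (rule Rats_in_quad_field) simp
  have num_in: "w1 * w1 + 2 * w1 \<in> quad_field s" "2 * w1 + 2 \<in> quad_field s" "n1 \<in> quad_field s"
    unfolding n1_def by (intro add_closed mult_closed w_in two_in)+
  have conj_2: "quad_conj s 2 = 2"
    by (rule conj_Rats) simp
  have conj_num: "quad_conj s (w1 * w1 + 2 * w1) = w2 * w2 + 2 * w2"
    "quad_conj s (2 * w1 + 2) = 2 * w2 + 2" "quad_conj s n1 = n2"
    unfolding n1_def n2_def
    by (simp_all add: conj_add conj_mult add_closed mult_closed w_in two_in conj_2 conj_w)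
  have \<alpha>\<beta>_in: "\<alpha> \<in> quad_field s" "\<beta> \<in> quad_field s"
    unfolding \<alpha>_def \<beta>_def using num_in by (simp_all add: divide_closed)
  have n1_ne: "n1 \<noteq> 0" and n2_ne: "n2 \<noteq> 0"
    using n_pos by simp_all
  have conj_\<alpha>\<beta>: "quad_conj s \<alpha> = (w2 * w2 + 2 * w2) / n2" "quad_conj s \<beta> = (2 * w2 + 2) / n2"
    unfolding \<alpha>_def \<beta>_def
    by (simp_all only: conj_divide[OF num_in(1,3) n1_ne] conj_divide[OF num_in(2,3) n1_ne] conj_num)
  have v1: "eigenvector M (vec_of_list [\<alpha>, \<beta>, 1]) (m1 * m1)"
    unfolding \<alpha>_def \<beta>_def sym_vec_null_point[OF n1_def n1_ne]
    by (rule symmetric_square_eigenvector[OF sq aw(1) cw(1) aw(1) cw(1)]) (use n1_ne in simp)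
  have v2: "eigenvector M (vec_of_list [quad_conj s \<alpha>, quad_conj s \<beta>, 1]) (m2 * m2)"
    unfolding conj_\<alpha>\<beta> sym_vec_null_point[OF n2_def n2_ne]
    by (rule symmetric_square_eigenvector[OF sq aw(2) cw(2) aw(2) cw(2)]) (use n2_ne in simp)
  have v3: "eigenvector M (Q_cross (vec_of_list [\<alpha>, \<beta>, 1])
      (vec_of_list [quad_conj s \<alpha>, quad_conj s \<beta>, 1])) (m1 * m2)"
    unfolding conj_\<alpha>\<beta> unfolding \<alpha>_def \<beta>_def Q_cross_null_points[OF n1_def n1_ne n2_def n2_ne]
    by (rule symmetric_square_eigenvector[OF sq aw(1) cw(1) aw(2) cw(2)])
       (use n1_ne n2_ne w_neq in simp)
  have M: "M \<in> carrier_mat 3 3"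
    using sq by (simp add: symmetric_square_def)
  have eigen_cases: "\<exists>x y z. v = sym_vec x y z \<and> \<not> (x = 0 \<and> y = 0 \<and> z = 0) \<and>
      M *\<^sub>v sym_vec x y z = l \<cdot>\<^sub>v sym_vec x y z"
    if "eigenvector M v l" for v l
  proof -
    from that M have v: "v \<in> carrier_vec 3" "v \<noteq> 0\<^sub>v 3" "M *\<^sub>v v = l \<cdot>\<^sub>v v"
      by (auto simp: eigenvector_def)
    from v(1) obtain x y z where "v = sym_vec x y z"
      by (rule sym_vec_cases)
    with v(2,3) show ?thesis
      using sym_vec_eq_0_iff by blast
  qed
  note dual_eigenvector = symmetric_square_dual_eigenvector[OF sq]
  \<comment> \<open>Subtracting the two forms leaves a multiple of y - w1 z, so their common kernel
    is the line spanned by the symmetric square of (w1, 1).\<close>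
  have line: "y = w1 * z \<and> x = w1 * w1 * z"
    if "x - (w1 + w1) * y + w1 * w1 * z = 0" "x - (w1 + w2) * y + w1 * w2 * z = 0" for x y z
  proof -
    have "(w2 - w1) * (y - w1 * z) = 0"
      using that by (simp add: algebra_simps)
    then have "y = w1 * z"
      using w_neq by simp
    then show ?thesis
      using that(1) by (simp add: algebra_simps)
  qed
  have spec: "spectrum M = {m1 * m1, m2 * m2, m1 * m2}"
  proof (intro equalityI subsetI)
    fix l assume "l \<in> spectrum M"
    then obtain v where "eigenvector M v l"
      unfolding spectrum_def eigenvalue_def by blast
    then obtain x y z where xyz: "\<not> (x = 0 \<and> y = 0 \<and> z = 0)"
      "M *\<^sub>v sym_vec x y z = l \<cdot>\<^sub>v sym_vec x y z"
      using eigen_cases by blast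
    show "l \<in> {m1 * m1, m2 * m2, m1 * m2}"
    proof (rule ccontr)
      assume "l \<notin> {m1 * m1, m2 * m2, m1 * m2}"
      then have l: "l \<noteq> m1 * m1" "l \<noteq> m2 * m2" "l \<noteq> m2 * m1"
        by (simp_all add: mult.commute)
      \<comment> \<open>If \<open>l\<close> differs from all three products, all three dual forms
        vanish on the eigenvector. Two of them confine it to a line, on which the remaining one is
        (w1 - w2)^2 z, so the vector would be zero.\<close>
      have f: "x - (w2 + w2) * y + w2 * w2 * z = 0" "x - (w1 + w1) * y + w1 * w1 * z = 0"
        "x - (w1 + w2) * y + w1 * w2 * z = 0"
        using dual_eigenvector[OF xyz(2) dual(1) bw(1) dual(1) bw(1) l(1)]
          dual_eigenvector[OF xyz(2) dual(2) bw(2) dual(2) bw(2) l(2)]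
          dual_eigenvector[OF xyz(2) dual(2) bw(2) dual(1) bw(1) l(3)] .
      from line[OF f(2,3)] have yx: "y = w1 * z" "x = w1 * w1 * z" by simp_all
      have "(w1 - w2) * ((w1 - w2) * z) = 0"
        using f(1) unfolding yx by (simp add: algebra_simps)
      then have "z = 0" using w_neq by simp
      with yx xyz(1) show False by simp
    qed
  next
    fix l assume "l \<in> {m1 * m1, m2 * m2, m1 * m2}"
    then show "l \<in> spectrum M"
      using v1 v2 v3 unfolding spectrum_def eigenvalue_def by blast
  qed
  have unique: "\<forall>v. eigenvector M v (m1 * m1) \<longrightarrow> Q_null v \<and> represents v (\<alpha>, \<beta>)"
  proof (intro allI impI)
    fix v assume v: "eigenvector M v (m1 * m1)"
    from eigen_cases[OF v] obtain x y z where xyz: "v = sym_vec x y z" "\<not> (x = 0 \<and> y = 0 \<and> z = 0)"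
      "M *\<^sub>v sym_vec x y z = (m1 * m1) \<cdot>\<^sub>v sym_vec x y z"
      by blast
    \<comment> \<open>Only the dual forms for the other two eigenvalues vanish here; they leave
      exactly the line through the null vector of \<open>w1\<close>.\<close>
    have f: "x - (w1 + w1) * y + w1 * w1 * z = 0" "x - (w1 + w2) * y + w1 * w2 * z = 0"
      using dual_eigenvector[OF xyz(3) dual(2) bw(2) dual(2) bw(2) l_neq(1)]
        dual_eigenvector[OF xyz(3) dual(2) bw(2) dual(1) bw(1) l_neq(2)] .
    from line[OF f] have yx: "y = w1 * z" "x = w1 * w1 * z" by simp_all
    with xyz(2) have z: "z \<noteq> 0" by auto
    have v_eq: "v = vec_of_list [(w1 * w1 + 2 * w1) * z, (2 * w1 + 2) * z, n1 * z]"
      unfolding xyz(1) sym_vec_def vec3_eq_iff yx n1_def by (simp add: algebra_simps)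
    have "((w1 * w1 + 2 * w1) * z)\<^sup>2 + ((2 * w1 + 2) * z)\<^sup>2 - (n1 * z)\<^sup>2 = 0"
      unfolding n1_def by (simp add: algebra_simps power2_eq_square)
    then have "Q_null v"
      unfolding Q_null_def v_eq One_nat_def vec3_index .
    moreover have "represents v (\<alpha>, \<beta>)"
      unfolding represents_def v_eq One_nat_def vec3_index \<alpha>_def \<beta>_def using z n1_ne by simp
    ultimately show "Q_null v \<and> represents v (\<alpha>, \<beta>)" ..
  qed
  have "\<alpha>\<^sup>2 + \<beta>\<^sup>2 = ((w1 * w1 + 2 * w1)\<^sup>2 + (2 * w1 + 2)\<^sup>2) / n1\<^sup>2"
    unfolding \<alpha>_def \<beta>_def power_divide add_divide_distrib[symmetric] ..
  \<comment> \<open>With m = w1 + 1 this is the Pythagorean identity (m^2 - 1)^2 + (2 m)^2 = (m^2 +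
    1)^2.\<close>
  also have "(w1 * w1 + 2 * w1)\<^sup>2 + (2 * w1 + 2)\<^sup>2 = n1\<^sup>2"
    unfolding n1_def by (simp add: algebra_simps power2_eq_square)
  finally have circle: "(\<alpha>, \<beta>) \<in> quarter_circle"
    using n1_ne n_pos w1_pos by (simp add: quarter_circle_def \<alpha>_def \<beta>_def)
  have conj_l1: "m2 * m2 = quad_conj s (m1 * m1)"
    using conj_mult[OF m_in m_in] conj_m by simp
  have l1_in: "m1 * m1 \<in> quad_field s"
    by (rule mult_closed[OF m_in m_in])
  have l3: "m1 * m2 = det M" "m1 * m2 \<in> {1, -1}"
    using m_prod det det_unit by simp_all
  have eigenvalues: "eigenvalue M (m1 * m1)" "eigenvalue M (m2 * m2)" "eigenvalue M (m1 * m2)"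
    using v1 v2 v3 unfolding eigenvalue_def by blast+
  show ?thesis
    by (rule exI[of _ "quad_field s"], rule exI[of _ "quad_conj s"], intro conjI,
        rule real_quadratic_field_quad_field, rule nontrivial_automorphism_quad_conj,
        rule exI[of _ "m1 * m1"], rule exI[of _ "m2 * m2"], rule exI[of _ "m1 * m2"],
        rule exI[of _ \<alpha>], rule exI[of _ \<beta>], (rule exI)+, intro conjI)
       (rule eigenvalues l1_gt l1_in conj_l1 l2_pos l2_lt l3 spec unique circle \<alpha>\<beta>_in
          refl v1 v2 v3)+
qed

end
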